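(* Let $(\mathcal G,\rho,\omega)$ be a symplectic Lie--Rinehart--Jacobi algebra over $A$ with extension $(\widehat{\mathcal G}_\omega,\widehat\rho)$, projection $\pi$ and canonical form $\eta$. For every $u=x+fe\in\widehat{\mathcal G}_\omega$ (with $x\in\mathcal G$, $f\in A$), $$\mathcal L^{\widehat\rho}_u(d_{\widehat\rho}\eta)=-\pi^*\bigl(\mathrm{curl}_\omega(x)\bigr).$$ In particular, $u$ preserves $d_{\widehat\rho}\eta$ (i.e. $\mathcal L^{\widehat\rho}_u(d_{\widehat\rho}\eta)=0$) if and only if $x\in\mathfrak{ham}_{\mathrm{loc}}$, and this condition does not depend on $f$.
   Context: $K$ is a commutative field of characteristic zero and $A$ a commutative unital $K$-algebra; $L_a$ is multiplication by $a$. $\mathrm{Diff}^1_K(A)$ is the set of $K$-linear $D:A\to A$ with $[[D,L_a],L_b]=0$ for all $a,b\in A$. A Lie--Rinehart--Jacobi (LRJ) algebra over $A$ is an $A$-module $\mathcal G$ with a $K$-Lie algebra structure and an $A$-linear map (anchor) $\rho:\mathcal G\to\mathrm{Diff}^1_K(A)$ which is a Lie algebra morphism and satisfies $[x,ay]=a[x,y]+(\rho(x)(a)-a\rho(x)(1_A))y$. $C^p_\rho(\mathcal G,A)=\mathrm{Alt}^p_A(\mathcal G,A)$ is the module of alternating $A$-multilinear maps $\mathcal G^p\to A$, with differential $(d_\rho\beta)(x_0,\dots,x_p)=\sum_i(-1)^i\rho(x_i)\beta(x_0,\dots,\widehat{x_i},\dots,x_p)+\sum_{i<j}(-1)^{i+j}\beta([x_i,x_j],x_0,\dots,\widehat{x_i},\dots,\widehat{x_j},\dots,x_p)$.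 $i_x$ is the interior product and $\mathcal L^\rho_x=i_xd_\rho+d_\rho i_x$. The same notation is used for any LRJ algebra. A symplectic form on $(\mathcal G,\rho)$ is $\omega\in C^2_\rho(\mathcal G,A)$ with $d_\rho\omega=0$ and $\omega^\flat:\mathcal G\to\mathcal G^*=\mathrm{Hom}_A(\mathcal G,A)$, $x\mapsto i_x\omega$, an isomorphism of $A$-modules; $(\mathcal G,\rho,\omega)$ is then a symplectic LRJ algebra. The symplectic curl is the $K$-linear map $\mathrm{curl}_\omega:\mathcal G\to C^2_\rho(\mathcal G,A)$, $x\mapsto\mathcal L^\rho_x\omega$, and $\mathfrak{ham}_{\mathrm{loc}}=\{x\in\mathcal G:\mathcal L^\rho_x\omega=0\}$. The extension: $\widehat{\mathcal G}_\omega=\mathcal G\oplus Ae$ with $e$ generating a free summand of rank one, with bracket $[x+fe,y+ge]_\omega=[x,y]+(\rho(x)(g)-\rho(y)(f)+\omega(x,y))e$, anchor $\widehat\rho(x+fe)=\rho(x)$, projection $\pi(x+fe)=x$ and canonical form $\eta(x+fe)=f$. $(\widehat{\mathcal G}_\omega,\widehat\rho)$ is an LRJ algebra. For $\beta\in C^p_\rho(\mathcal G,A)$, $(\pi^*\beta)(u_1,\dots,u_p)=\beta(\pi(u_1),\dots,\pi(u_p))$. *)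

theory Defs
  imports Complex_Main "HOL-Library.Product_Plus"
begin

text \<open>
  The commutative unital ring underlying \<open>A\<close> is the type \<open>'a\<close>, its \<open>K\<close>-algebra structure is the
  scalar multiplication \<open>sA\<close>.  The \<open>A\<close>-module \<open>G\<close> is the type \<open>'g\<close> with scalar multiplication \<open>sG\<close>.
\<close>

locale comm_algebra = vector_space sA
  for sA :: "'k::field_char_0 \<Rightarrow> 'a::comm_ring_1 \<Rightarrow> 'a" +
  assumes scale_mult: "sA c (a * b) = sA c a * b"

text \<open>The \<open>K\<close>-scalar multiplication that an \<open>A\<close>-module inherits along \<open>K \<rightarrow> A\<close>.\<close>

definition restrict_scalars ::
    "('k \<Rightarrow> 'a::comm_ring_1 \<Rightarrow> 'a) \<Rightarrow> ('a \<Rightarrow> 'g \<Rightarrow> 'g) \<Rightarrow> 'k \<Rightarrow> 'g \<Rightarrow> 'g" where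
  "restrict_scalars sA sG c x = sG (sA c 1) x"

definition commutator :: "('v \<Rightarrow> 'v) \<Rightarrow> ('v \<Rightarrow> 'v) \<Rightarrow> 'v \<Rightarrow> 'v::ab_group_add" where
  "commutator D E = (\<lambda>v. D (E v) - E (D v))"

definition Diff1 :: "('k::field_char_0 \<Rightarrow> 'a::comm_ring_1 \<Rightarrow> 'a) \<Rightarrow> ('a \<Rightarrow> 'a) set" where
  "Diff1 sA = {D. Vector_Spaces.linear sA sA D \<and>
     (\<forall>a b. commutator (commutator D ((*) a)) ((*) b) = (\<lambda>_. 0))}"

locale lie_algebra =
  fixes s :: "'k::field \<Rightarrow> 'g::ab_group_add \<Rightarrow> 'g" and br :: "'g \<Rightarrow> 'g \<Rightarrow> 'g"
  assumes bracket_linear_left: "Vector_Spaces.linear s s (\<lambda>x. br x y)"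
    and bracket_linear_right: "Vector_Spaces.linear s s (\<lambda>y. br x y)"
    and bracket_self: "br x x = 0"
    and jacobi: "br x (br y z) + br y (br z x) + br z (br x y) = 0"

locale lrj_algebra =
  A: comm_algebra sA + G: module sG + lie_algebra "restrict_scalars sA sG" br
  for sA :: "'k::field_char_0 \<Rightarrow> 'a::comm_ring_1 \<Rightarrow> 'a"
    and sG :: "'a \<Rightarrow> 'g::ab_group_add \<Rightarrow> 'g"
    and br :: "'g \<Rightarrow> 'g \<Rightarrow> 'g"
    and \<rho> :: "'g \<Rightarrow> 'a \<Rightarrow> 'a" +
  assumes anchor_Diff1: "\<rho> x \<in> Diff1 sA"
    and anchor_add: "\<rho> (x + y) a = \<rho> x a + \<rho> y a"
    and anchor_scale: "\<rho> (sG b x) a = b * \<rho> x a"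
    and anchor_bracket: "\<rho> (br x y) = commutator (\<rho> x) (\<rho> y)"
    and bracket_scale: "br x (sG a y) = sG a (br x y) + sG (\<rho> x a - a * \<rho> x 1) y"

text \<open>
  A \<open>p\<close>-cochain takes its \<open>p\<close> arguments as a list and is \<open>0\<close> on lists of any other length, so that
  equality of cochains is equality of functions.  With this convention the operators below need no
  degree parameter; in particular the interior product vanishes on \<open>0\<close>-cochains.
\<close>

definition cochains ::
    "('a::comm_ring_1 \<Rightarrow> 'g::ab_group_add \<Rightarrow> 'g) \<Rightarrow> nat \<Rightarrow> ('g list \<Rightarrow> 'a) set" where
  "cochains sG p = {\<beta>.
     (\<forall>xs. length xs \<noteq> p \<longrightarrow> \<beta> xs = 0) \<and>
     (\<forall>xs i. length xs = p \<longrightarrow> i < p \<longrightarrow> module_hom sG (*) (\<lambda>x. \<beta> (xs[i := x]))) \<and>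
     (\<forall>xs. length xs = p \<longrightarrow> \<not> distinct xs \<longrightarrow> \<beta> xs = 0)}"

text \<open>\<open>nths xs (- I)\<close> is the list \<open>xs\<close> with the entries at the positions in \<open>I\<close> omitted.\<close>

definition differential ::
    "('g \<Rightarrow> 'g \<Rightarrow> 'g) \<Rightarrow> ('g \<Rightarrow> 'a \<Rightarrow> 'a) \<Rightarrow> ('g list \<Rightarrow> 'a) \<Rightarrow> 'g list \<Rightarrow> 'a::comm_ring_1" where
  "differential br \<rho> \<beta> xs =
     (\<Sum>i<length xs. (- 1) ^ i * \<rho> (xs ! i) (\<beta> (nths xs (- {i})))) +
     (\<Sum>j<length xs. \<Sum>i<j. (- 1) ^ (i + j) * \<beta> (br (xs ! i) (xs ! j) # nths xs (- {i, j})))"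

definition interior :: "'g \<Rightarrow> ('g list \<Rightarrow> 'a) \<Rightarrow> 'g list \<Rightarrow> 'a" where
  "interior x \<beta> xs = \<beta> (x # xs)"

definition lie_derivative ::
    "('g \<Rightarrow> 'g \<Rightarrow> 'g) \<Rightarrow> ('g \<Rightarrow> 'a \<Rightarrow> 'a) \<Rightarrow> 'g \<Rightarrow> ('g list \<Rightarrow> 'a) \<Rightarrow> 'g list \<Rightarrow> 'a::comm_ring_1" where
  "lie_derivative br \<rho> x \<beta> =
     (\<lambda>xs. interior x (differential br \<rho> \<beta>) xs + differential br \<rho> (interior x \<beta>) xs)"

definition dual :: "('a::comm_ring_1 \<Rightarrow> 'g::ab_group_add \<Rightarrow> 'g) \<Rightarrow> ('g \<Rightarrow> 'a) set" where
  "dual sG = {\<phi>. module_hom sG (*) \<phi>}"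

definition flat :: "('g list \<Rightarrow> 'a) \<Rightarrow> 'g \<Rightarrow> 'g \<Rightarrow> 'a" where
  "flat \<omega> x = (\<lambda>y. interior x \<omega> [y])"

locale symplectic_lrj_algebra = lrj_algebra sA sG br \<rho>
  for sA :: "'k::field_char_0 \<Rightarrow> 'a::comm_ring_1 \<Rightarrow> 'a"
    and sG :: "'a \<Rightarrow> 'g::ab_group_add \<Rightarrow> 'g"
    and br :: "'g \<Rightarrow> 'g \<Rightarrow> 'g"
    and \<rho> :: "'g \<Rightarrow> 'a \<Rightarrow> 'a" +
  fixes \<omega> :: "'g list \<Rightarrow> 'a"
  assumes form: "\<omega> \<in> cochains sG 2"
    and closed: "differential br \<rho> \<omega> = (\<lambda>_. 0)"
    and flat_add: "flat \<omega> (x + y) = (\<lambda>z. flat \<omega> x z + flat \<omega> y z)"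
    and flat_scale: "flat \<omega> (sG a x) = (\<lambda>z. a * flat \<omega> x z)"
    and flat_bij: "bij_betw (flat \<omega>) UNIV (dual sG)"

definition curl ::
    "('g \<Rightarrow> 'g \<Rightarrow> 'g) \<Rightarrow> ('g \<Rightarrow> 'a \<Rightarrow> 'a) \<Rightarrow> ('g list \<Rightarrow> 'a) \<Rightarrow> 'g \<Rightarrow> 'g list \<Rightarrow> 'a::comm_ring_1" where
  "curl br \<rho> \<omega> x = lie_derivative br \<rho> x \<omega>"

definition ham_loc ::
    "('g \<Rightarrow> 'g \<Rightarrow> 'g) \<Rightarrow> ('g \<Rightarrow> 'a \<Rightarrow> 'a) \<Rightarrow> ('g list \<Rightarrow> 'a::comm_ring_1) \<Rightarrow> 'g set" where
  "ham_loc br \<rho> \<omega> = {x. lie_derivative br \<rho> x \<omega> = (\<lambda>_. 0)}"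

text \<open>The element \<open>x + f e\<close> of the extension \<open>G \<oplus> A e\<close> is the pair \<open>(x, f)\<close>.\<close>

definition ext_scale :: "('a \<Rightarrow> 'g \<Rightarrow> 'g) \<Rightarrow> 'a \<Rightarrow> 'g \<times> 'a \<Rightarrow> 'g \<times> 'a::comm_ring_1" where
  "ext_scale sG a = (\<lambda>(x, f). (sG a x, a * f))"

definition ext_bracket ::
    "('g \<Rightarrow> 'g \<Rightarrow> 'g) \<Rightarrow> ('g \<Rightarrow> 'a \<Rightarrow> 'a) \<Rightarrow> ('g list \<Rightarrow> 'a) \<Rightarrow>
     'g \<times> 'a \<Rightarrow> 'g \<times> 'a \<Rightarrow> 'g \<times> 'a::comm_ring_1" where
  "ext_bracket br \<rho> \<omega> = (\<lambda>(x, f) (y, g). (br x y, \<rho> x g - \<rho> y f + \<omega> [x, y]))"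

definition ext_anchor :: "('g \<Rightarrow> 'a \<Rightarrow> 'a) \<Rightarrow> 'g \<times> 'a \<Rightarrow> 'a \<Rightarrow> 'a" where
  "ext_anchor \<rho> = (\<lambda>(x, f). \<rho> x)"

definition ext_proj :: "'g \<times> 'a \<Rightarrow> 'g" where
  "ext_proj = (\<lambda>(x, f). x)"

text \<open>The canonical form \<open>\<eta>\<close>, as a \<open>1\<close>-cochain on the extension.\<close>

definition ext_form :: "('g \<times> 'a) list \<Rightarrow> 'a::comm_ring_1" where
  "ext_form us = (case us of [(x, f)] \<Rightarrow> f | _ \<Rightarrow> 0)"

definition pullback :: "('h \<Rightarrow> 'g) \<Rightarrow> ('g list \<Rightarrow> 'a) \<Rightarrow> 'h list \<Rightarrow> 'a" where
  "pullback p \<beta> us = \<beta> (map p us)"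


context symplectic_lrj_algebra
begin

lemma form_linear:
  shows "module_hom sG (*) (\<lambda>x. \<omega> [x, y])" and "module_hom sG (*) (\<lambda>y. \<omega> [x, y])"
proof -
  have *: "module_hom sG (*) (\<lambda>z. \<omega> (xs[i := z]))" if "length xs = 2" "i < 2" for xs i
    using form that by (auto simp: cochains_def)
  show "module_hom sG (*) (\<lambda>x. \<omega> [x, y])" using *[of "[y, y]" 0] by simp
  show "module_hom sG (*) (\<lambda>y. \<omega> [x, y])" using *[of "[x, x]" 1] by simp
qed

lemma form_simps:
  "\<omega> [x + x', y] = \<omega> [x, y] + \<omega> [x', y]" "\<omega> [y, x + x'] = \<omega> [y, x] + \<omega> [y, x']"
  "\<omega> [sG a x, y] = a * \<omega> [x, y]" "\<omega> [y, sG a x] = a * \<omega> [y, x]" "\<omega> [x, x] = 0"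
proof -
  show "\<omega> [x + x', y] = \<omega> [x, y] + \<omega> [x', y]" "\<omega> [sG a x, y] = a * \<omega> [x, y]"
    using module_hom.add[OF form_linear(1)] module_hom.scale[OF form_linear(1)] by auto
  show "\<omega> [y, x + x'] = \<omega> [y, x] + \<omega> [y, x']" "\<omega> [y, sG a x] = a * \<omega> [y, x]"
    using module_hom.add[OF form_linear(2)] module_hom.scale[OF form_linear(2)] by auto
  show "\<omega> [x, x] = 0" using form by (auto simp: cochains_def)
qed

lemma form_swap: "\<omega> [y, x] = - \<omega> [x, y]"
proof -
  have "\<omega> [x, y] + \<omega> [y, x] = 0"
    using form_simps(5)[of "x + y"] by (simp only: form_simps(1,2) form_simps(5)[of x] form_simps(5)[of y]) (simp add: add.commute)
  then show ?thesis by (simp add: eq_neg_iff_add_eq_0 add.commute)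
qed

lemma form_closed:
  "\<rho> x (\<omega> [y, z]) - \<rho> y (\<omega> [x, z]) + \<rho> z (\<omega> [x, y])
     - \<omega> [br x y, z] + \<omega> [br x z, y] - \<omega> [br y z, x] = 0"
  using fun_cong[OF closed, of "[x, y, z]"]
  by (simp add: differential_def nths_Cons lessThan_Suc eval_nat_numeral algebra_simps)

lemma br_simps:
  "br (x + x') y = br x y + br x' y" "br y (x + x') = br y x + br y x'"
  "br (sG (sA c 1) x) y = sG (sA c 1) (br x y)" "br y (sG (sA c 1) x) = sG (sA c 1) (br y x)"
  using bracket_linear_left bracket_linear_right
  by (auto simp: Vector_Spaces.linear_iff restrict_scalars_def)

lemma anchor_linear: "Vector_Spaces.linear sA sA (\<rho> x)"
  using anchor_Diff1[of x] by (simp add: Diff1_def)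

lemma rho_simps:
  "\<rho> x (a + b) = \<rho> x a + \<rho> x b" "\<rho> x (sA c a) = sA c (\<rho> x a)" "\<rho> x 0 = 0"
  "\<rho> x (- a) = - \<rho> x a" "\<rho> x (a - b) = \<rho> x a - \<rho> x b"
proof -
  interpret h: Vector_Spaces.linear sA sA "\<rho> x" by (rule anchor_linear)
  show "\<rho> x (a + b) = \<rho> x a + \<rho> x b" "\<rho> x (sA c a) = sA c (\<rho> x a)" "\<rho> x 0 = 0"
  "\<rho> x (- a) = - \<rho> x a" "\<rho> x (a - b) = \<rho> x a - \<rho> x b"
    by (simp_all add: h.add h.scale h.zero h.neg h.diff)
qed

lemma sA_one: "sA c a = sA c 1 * a"
  using A.scale_mult[of c 1 a] by simp

lemma rho_mult: "\<rho> x (a * b) = a * \<rho> x b + b * \<rho> x a - a * b * \<rho> x 1"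
proof -
  have "commutator (commutator (\<rho> x) ((*) a)) ((*) b) 1 = 0"
    using anchor_Diff1[of x] by (simp add: Diff1_def)
  then show ?thesis by (simp add: commutator_def algebra_simps)
qed

lemma rho_sA: "\<rho> x (sA c 1 * a) = sA c 1 * \<rho> x a"
  "\<rho> x (a * sA c 1) = \<rho> x a * sA c 1"
  by (metis rho_simps(2) sA_one mult.commute)+

lemma lrj_algebra_extension:
  "lrj_algebra sA (ext_scale sG) (ext_bracket br \<rho> \<omega>) (ext_anchor \<rho>)"
proof -
  interpret E: module "ext_scale sG"
    by standard (auto simp: ext_scale_def G.scale_right_distrib G.scale_left_distrib algebra_simps)
  have V: "vector_space (restrict_scalars sA (ext_scale sG))"
    by standard (auto simp: restrict_scalars_def A.scale_left_distrib E.scale_right_distrib 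
      E.scale_left_distrib sA_one[symmetric] simp del: A.scale_scale simp flip: A.scale_scale)
  show ?thesis
  proof (intro lrj_algebra.intro lie_algebra.intro lrj_algebra_axioms.intro)
    show "comm_algebra sA" "module (ext_scale sG)" by unfold_locales
    show "Vector_Spaces.linear (restrict_scalars sA (ext_scale sG)) (restrict_scalars sA (ext_scale sG))
       (\<lambda>x. ext_bracket br \<rho> \<omega> x y)" for y
      using V by (cases y) (auto simp: Vector_Spaces.linear_iff ext_bracket_def ext_scale_def restrict_scalars_def
        br_simps rho_simps rho_sA form_simps anchor_add anchor_scale algebra_simps)
    show "Vector_Spaces.linear (restrict_scalars sA (ext_scale sG)) (restrict_scalars sA (ext_scale sG))
       (\<lambda>x. ext_bracket br \<rho> \<omega> y x)" for y
      using V by (cases y) (auto simp: Vector_Spaces.linear_iff ext_bracket_def ext_scale_def restrict_scalars_def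
        br_simps rho_simps rho_sA form_simps anchor_add anchor_scale algebra_simps)
    show "ext_bracket br \<rho> \<omega> x x = 0" for x
      by (auto simp: ext_bracket_def bracket_self form_simps zero_prod_def split: prod.split)
    show "ext_bracket br \<rho> \<omega> x (ext_bracket br \<rho> \<omega> y z) +
       ext_bracket br \<rho> \<omega> y (ext_bracket br \<rho> \<omega> z x) +
       ext_bracket br \<rho> \<omega> z (ext_bracket br \<rho> \<omega> x y) = 0" for x y z
    proof -
      obtain x1 f y1 g z1 h where [simp]: "x = (x1, f)" "y = (y1, g)" "z = (z1, h)"
        by (metis surj_pair)
      have b: "br z1 x1 = - br x1 z1"
      proof -
        have "br z1 x1 + br x1 z1 = 0"
          using bracket_self[of "z1 + x1"]
          by (simp only: br_simps(1,2) bracket_self[of z1] bracket_self[of x1]) (simp add: add.commute)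
        then show ?thesis by (simp add: eq_neg_iff_add_eq_0)
      qed
      have n: "\<omega> [- u, v] = - \<omega> [u, v]" "\<omega> [v, - u] = - \<omega> [v, u]" for u v
        using module_hom.neg[OF form_linear(1)] module_hom.neg[OF form_linear(2)] by auto
      have "\<omega> [x1, br y1 z1] + \<omega> [y1, br z1 x1] + \<omega> [z1, br x1 y1]
          + \<rho> x1 (\<omega> [y1, z1]) + \<rho> y1 (\<omega> [z1, x1]) + \<rho> z1 (\<omega> [x1, y1]) = 0"
        using form_closed[of x1 y1 z1]
        by (simp add: b n form_swap[of _ "br _ _"] form_swap[of z1 x1] rho_simps algebra_simps)
      then show ?thesis
        using jacobi[of x1 y1 z1]
        by (simp add: ext_bracket_def zero_prod_def rho_simps anchor_bracket commutator_def algebra_simps)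
    qed
    show "ext_anchor \<rho> x \<in> Diff1 sA" for x
      using anchor_Diff1 by (auto simp: ext_anchor_def split: prod.split)
    show "ext_anchor \<rho> (x + y) a = ext_anchor \<rho> x a + ext_anchor \<rho> y a" for x y a
      by (auto simp: ext_anchor_def anchor_add split: prod.split)
    show "ext_anchor \<rho> (ext_scale sG b x) a = b * ext_anchor \<rho> x a" for x b a
      by (auto simp: ext_anchor_def ext_scale_def anchor_scale split: prod.split)
    show "ext_anchor \<rho> (ext_bracket br \<rho> \<omega> x y) = commutator (ext_anchor \<rho> x) (ext_anchor \<rho> y)" for x y
      by (auto simp: ext_anchor_def ext_bracket_def anchor_bracket split: prod.split)
    show "ext_bracket br \<rho> \<omega> x (ext_scale sG a y) = ext_scale sG a (ext_bracket br \<rho> \<omega> x y)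
       + ext_scale sG (ext_anchor \<rho> x a - a * ext_anchor \<rho> x 1) y" for x a y
      by (auto simp: ext_anchor_def ext_bracket_def ext_scale_def bracket_scale rho_mult
          form_simps anchor_scale algebra_simps split: prod.split)
  qed
qed

end

lemma ext_form_cochain:
  assumes "module sG"
  shows "ext_form \<in> cochains (ext_scale sG) 1"
proof -
  interpret module sG by fact
  interpret E: module "ext_scale sG"
    by standard (auto simp: ext_scale_def scale_right_distrib scale_left_distrib algebra_simps)
  show ?thesis
    by (auto simp: cochains_def ext_form_def length_Suc_conv module_hom_iff E.module_axioms
       module_def ext_scale_def algebra_simps split: list.split)
qed

end

theory Submission
  imports Defs
begin

text \<open>
  Evaluating \<open>d\<eta>\<close> on \<open>x + f e\<close> and \<open>y + g e\<close>, the terms \<open>\<rho> x g - \<rho> y f\<close> cancel against the same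
  terms in the \<open>e\<close>-component of the bracket, and only the twist \<open>- \<omega> [x, y]\<close> survives.  Hence
  \<open>d\<eta> = - \<pi>\<^sup>*\<omega>\<close> (lemma \<open>differential_ext_form\<close>).  On the other hand \<open>\<pi>\<close> intertwines the two
  brackets and the two anchors, so pullback along \<open>\<pi>\<close> commutes with the differential, the interior
  product and therefore the Lie derivative (lemma \<open>lie_derivative_pullback\<close>):
  \<open>L\<^sub>u (d\<eta>) = - L\<^sub>u (\<pi>\<^sup>*\<omega>) = - \<pi>\<^sup>*(L\<^sub>x \<omega>)\<close> for \<open>u = x + f e\<close>.  The equivalence with \<open>L\<^sub>x \<omega> = 0\<close>
  then holds because \<open>\<pi>\<close> is surjective, so that \<open>\<pi>\<^sup>*\<close> is injective; and \<open>f\<close> does not occur in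
  the right-hand side.
\<close>

text \<open>
  The differential is built from bracket and anchor alone, and selecting entries of a list commutes
  with applying a map to all of them.  So compatibility with bracket and anchor is
  enough, whatever the degree.
\<close>

lemma differential_pullback:
  assumes bracket: "\<And>u v. p (br' u v) = br (p u) (p v)"
    and anchor: "\<And>u. \<rho>' u = \<rho> (p u)"
  shows "differential br' \<rho>' (pullback p \<beta>) = pullback p (differential br \<rho> \<beta>)"
  by (rule ext)
    (auto simp: differential_def pullback_def nths_map bracket anchor
      intro!: sum.cong arg_cong2[of _ _ _ _ "(+)"])

lemma interior_pullback: "interior u (pullback p \<beta>) = pullback p (interior (p u) \<beta>)"
  by (rule ext) (simp add: interior_def pullback_def)

lemma lie_derivative_pullback:
  assumes "\<And>u v. p (br' u v) = br (p u) (p v)"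
    and "\<And>u. \<rho>' u = \<rho> (p u)"
  shows "lie_derivative br' \<rho>' u (pullback p \<beta>) = pullback p (lie_derivative br \<rho> (p u) \<beta>)"
  unfolding lie_derivative_def interior_pullback
    differential_pullback[of p br' br \<rho>' \<rho>, OF assms] interior_pullback
  by (simp add: pullback_def fun_eq_iff)

lemma pullback_eq_zero_iff:
  assumes "surj p"
  shows "pullback p \<beta> = (\<lambda>_. 0) \<longleftrightarrow> \<beta> = (\<lambda>_. 0)"
proof
  assume zero: "pullback p \<beta> = (\<lambda>_. 0)"
  have "\<beta> xs = 0" for xs
  proof -
    have "map p (map (inv p) xs) = xs"
      using assms by (simp add: surj_iff)
    then show ?thesis using fun_cong[OF zero, of "map (inv p) xs"] by (simp add: pullback_def)
  qed
  then show "\<beta> = (\<lambda>_. 0)" by blast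
qed (simp add: pullback_def fun_eq_iff)

lemma differential_uminus:
  assumes "\<And>x a. \<rho> x (- a) = - \<rho> x a"
  shows "differential br \<rho> (\<lambda>xs. - \<beta> xs) xs = - differential br \<rho> \<beta> xs"
  by (simp add: differential_def assms sum_negf)

lemma lie_derivative_uminus:
  assumes "\<And>x a. \<rho> x (- a) = - \<rho> x a"
  shows "lie_derivative br \<rho> x (\<lambda>xs. - \<beta> xs) = (\<lambda>xs. - lie_derivative br \<rho> x \<beta> xs)"
proof -
  have "interior x (\<lambda>xs. - \<beta> xs) = (\<lambda>xs. - interior x \<beta> xs)"
    by (rule ext) (simp add: interior_def)
  moreover have "interior x (differential br \<rho> (\<lambda>xs. - \<beta> xs)) xs
      = - interior x (differential br \<rho> \<beta>) xs" for xs
    unfolding interior_def by (rule differential_uminus) (rule assms)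
  moreover have "differential br \<rho> (\<lambda>xs. - interior x \<beta> xs) xs
      = - differential br \<rho> (interior x \<beta>) xs" for xs
    by (rule differential_uminus) (rule assms)
  ultimately show ?thesis by (simp add: lie_derivative_def)
qed

lemma ext_proj_bracket: "ext_proj (ext_bracket br \<rho> \<omega> u v) = br (ext_proj u) (ext_proj v)"
  by (simp add: ext_proj_def ext_bracket_def split: prod.split)

lemma ext_anchor_proj: "ext_anchor \<rho> u = \<rho> (ext_proj u)"
  by (simp add: ext_anchor_def ext_proj_def split: prod.split)

lemma surj_ext_proj: "surj ext_proj"
  by (simp add: surj_def ext_proj_def)

lemma ext_form_eq_zero: "length us \<noteq> 1 \<Longrightarrow> ext_form us = 0"
  by (auto simp: ext_form_def split: list.split)

text \<open>
  This is an equality of functions on lists of every length, since both sides vanish outside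
  degree \<open>2\<close>.
\<close>

lemma (in symplectic_lrj_algebra) differential_ext_form:
  "differential (ext_bracket br \<rho> \<omega>) (ext_anchor \<rho>) ext_form
    = (\<lambda>us. - pullback ext_proj \<omega> us)"
proof
  fix us :: "('g \<times> 'a) list"
  show "differential (ext_bracket br \<rho> \<omega>) (ext_anchor \<rho>) ext_form us = - pullback ext_proj \<omega> us"
  proof (cases "length us = 2")
    case True
    then obtain u v where us: "us = [u, v]"
      by (auto simp: length_Suc_conv numeral_2_eq_2)
    show ?thesis
      by (cases u; cases v)
        (simp add: us differential_def nths_Cons lessThan_Suc eval_nat_numeral pullback_def
          ext_form_def ext_anchor_def ext_bracket_def ext_proj_def)
  next
    case False
    \<comment> \<open>Every term of the differential evaluates \<open>\<eta>\<close> on a list shorter by one, hence not of length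
      \<open>1\<close>.\<close>
    have one: "ext_form (nths us (- {i})) = 0" if "i < length us" for i
    proof -
      have "{k. k < length us \<and> k \<in> - {i}} = {..<length us} - {i}" by auto
      then show ?thesis using that False by (intro ext_form_eq_zero) (simp add: length_nths)
    qed
    have two: "nths us (- {i, j}) \<noteq> []" if "i < j" "j < length us" for i j
    proof -
      have "{k. k < length us \<and> k \<in> - {i, j}} = {..<length us} - {i, j}" by auto
      then have "length (nths us (- {i, j})) = length us - 2"
        using that by (simp add: length_nths card_Diff_subset)
      then show ?thesis using that False by auto
    qed
    have "\<omega> (map ext_proj us) = 0"
      using form False by (simp add: cochains_def)
    moreover have "ext_anchor \<rho> u 0 = 0" for u
      by (simp add: ext_anchor_proj rho_simps)
    ultimately show ?thesis
      by (simp add: differential_def pullback_def ext_form_eq_zero one two)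
  qed
qed

theorem proposition8p1:
  fixes sA :: "'k::field_char_0 \<Rightarrow> 'a::comm_ring_1 \<Rightarrow> 'a"
    and sG :: "'a \<Rightarrow> 'g::ab_group_add \<Rightarrow> 'g"
    and br :: "'g \<Rightarrow> 'g \<Rightarrow> 'g"
    and \<rho> :: "'g \<Rightarrow> 'a \<Rightarrow> 'a"
    and \<omega> :: "'g list \<Rightarrow> 'a"
  assumes "symplectic_lrj_algebra sA sG br \<rho> \<omega>"
  defines "L_hat \<equiv> lie_derivative (ext_bracket br \<rho> \<omega>) (ext_anchor \<rho>)"
    and "d\<eta> \<equiv> differential (ext_bracket br \<rho> \<omega>) (ext_anchor \<rho>) ext_form"
  shows "(\<forall>x f. L_hat (x, f) d\<eta> = (\<lambda>us. - pullback ext_proj (curl br \<rho> \<omega> x) us)) \<and>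
    (\<forall>x f. L_hat (x, f) d\<eta> = (\<lambda>_. 0) \<longleftrightarrow> x \<in> ham_loc br \<rho> \<omega>) \<and>
    (\<forall>x f g. L_hat (x, f) d\<eta> = (\<lambda>_. 0) \<longleftrightarrow> L_hat (x, g) d\<eta> = (\<lambda>_. 0))"
proof -
  interpret symplectic_lrj_algebra sA sG br \<rho> \<omega> by fact
  have neg: "ext_anchor \<rho> u (- a) = - ext_anchor \<rho> u a" for u a
    by (simp add: ext_anchor_proj rho_simps)
  have formula: "L_hat (x, f) d\<eta> = (\<lambda>us. - pullback ext_proj (curl br \<rho> \<omega> x) us)" for x f
  proof -
    have "L_hat (x, f) d\<eta> = (\<lambda>us. - L_hat (x, f) (pullback ext_proj \<omega>) us)"
      unfolding L_hat_def d\<eta>_def differential_ext_form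
      by (rule lie_derivative_uminus[of "ext_anchor \<rho>", OF neg])
    also have "L_hat (x, f) (pullback ext_proj \<omega>) = pullback ext_proj (curl br \<rho> \<omega> x)"
      unfolding L_hat_def curl_def
      by (subst lie_derivative_pullback[of ext_proj "ext_bracket br \<rho> \<omega>" br "ext_anchor \<rho>" \<rho>, OF ext_proj_bracket ext_anchor_proj])
        (simp add: ext_proj_def)
    finally show ?thesis .
  qed
  have preserved: "L_hat (x, f) d\<eta> = (\<lambda>_. 0) \<longleftrightarrow> x \<in> ham_loc br \<rho> \<omega>" for x f
  proof -
    have "L_hat (x, f) d\<eta> = (\<lambda>_. 0) \<longleftrightarrow> pullback ext_proj (curl br \<rho> \<omega> x) = (\<lambda>_ :: ('g \<times> 'a) list. 0)"
      by (simp add: formula fun_eq_iff)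
    also have "\<dots> \<longleftrightarrow> curl br \<rho> \<omega> x = (\<lambda>_. 0)"
      by (rule pullback_eq_zero_iff[OF surj_ext_proj])
    finally show ?thesis by (simp add: curl_def ham_loc_def)
  qed
  show ?thesis using formula preserved by simp
qed

end
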